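(* Let $0<s<d$ and let $E\subset\mathbb{R}^d$ be a compact $s$-regular set containing at least two points. Then there are constants $C\ge1$, $c>0$, and $r_0>0$ such that $$c\,r^{d-1-s}\le\mathcal{H}^{d-1}(\partial E_r)\le C\,r^{d-1-s}\qquad\text{for all }0<r<r_0.$$
   Context: A set $E\subset\mathbb{R}^d$ is $s$-regular if, as a metric space with the relative metric, it carries a measure $\mu$ for which there is a constant $A\ge1$ with $A^{-1}r^s\le\mu(B(x,r))\le Ar^s$ for all $x\in E$ and $0<r<\operatorname{diam}(E)$ (closed balls; a measure is a nontrivial Borel regular outer measure for which bounded sets have finite measure). $E_r=\{x\in\mathbb{R}^d:\operatorname{dist}(x,E)<r\}$, $\partial E_r=\{x\in\mathbb{R}^d:\operatorname{dist}(x,E)=r\}$, and $\mathcal{H}^{d-1}$ is the $(d-1)$-dimensional Hausdorff measure. *)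

theory Defs
  imports "HOL-Analysis.Analysis"
begin

text \<open>
  Outer measures on a subset \<open>E\<close> of a metric space are functions on sets of which only the values
  on subsets of \<open>E\<close> matter. The library's \<open>countably_subadditive\<close> quantifies over disjoint
  families only; together with monotonicity on \<open>Pow E\<close> this is the usual countable subadditivity.
  The Borel sets of \<open>E\<close> with the relative metric are \<open>sets (restrict_space borel E)\<close>, and
  \<open>lambda_system\<close> is the family of Caratheodory measurable sets.
\<close>

definition borel_regular_outer_measure :: "'a::metric_space set \<Rightarrow> ('a set \<Rightarrow> ennreal) \<Rightarrow> bool" where
  "borel_regular_outer_measure E \<mu> \<longleftrightarrow>
     outer_measure_space (Pow E) \<mu> \<and>
     sets (restrict_space borel E) \<subseteq> lambda_system E (Pow E) \<mu> \<and>
     (\<forall>S\<subseteq>E. \<exists>B\<in>sets (restrict_space borel E). S \<subseteq> B \<and> \<mu> B = \<mu> S)"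

definition metric_measure :: "'a::metric_space set \<Rightarrow> ('a set \<Rightarrow> ennreal) \<Rightarrow> bool" where
  "metric_measure E \<mu> \<longleftrightarrow>
     borel_regular_outer_measure E \<mu> \<and> \<mu> E > 0 \<and> (\<forall>S\<subseteq>E. bounded S \<longrightarrow> \<mu> S < \<infinity>)"

text \<open>
  \<open>diameter\<close> is real-valued and has no meaningful value on unbounded sets. The guard
  \<open>bounded E \<longrightarrow> r < diameter E\<close> expresses \<open>r < diam E\<close>, with an infinite diameter when \<open>E\<close> is
  unbounded.
\<close>

definition regular_set :: "real \<Rightarrow> 'a::metric_space set \<Rightarrow> bool" where
  "regular_set s E \<longleftrightarrow>
     (\<exists>\<mu>. metric_measure E \<mu> \<and>
       (\<exists>A\<ge>1. \<forall>x\<in>E. \<forall>r>0. (bounded E \<longrightarrow> r < diameter E) \<longrightarrow>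
          ennreal (inverse A * r powr s) \<le> \<mu> (cball x r \<inter> E) \<and>
          \<mu> (cball x r \<inter> E) \<le> ennreal (A * r powr s)))"

text \<open>
  The summand \<open>diam(U)\<^sup>t\<close> of the Hausdorff measure, with the conventions that the empty set
  contributes \<open>0\<close> and that \<open>0\<^sup>0 = 1\<close> for nonempty \<open>U\<close>, so that the \<open>0\<close>-dimensional measure is the
  counting measure (in Isabelle, \<open>0 powr 0 = 0\<close>).
\<close>

definition hausdorff_gauge :: "real \<Rightarrow> 'a::metric_space set \<Rightarrow> ennreal" where
  "hausdorff_gauge t U =
     (if U = {} then 0 else if t = 0 then 1 else ennreal (diameter U powr t))"

definition hausdorff_content :: "real \<Rightarrow> real \<Rightarrow> 'a::metric_space set \<Rightarrow> ennreal" where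
  "hausdorff_content t \<delta> S =
     (INF U\<in>{U :: nat \<Rightarrow> 'a set. S \<subseteq> (\<Union>i. U i) \<and> (\<forall>i. bounded (U i) \<and> diameter (U i) \<le> \<delta>)}.
        \<Sum>i. hausdorff_gauge t (U i))"

text \<open>
  The \<open>t\<close>-dimensional Hausdorff (outer) measure, for \<open>t \<ge> 0\<close>, without a normalizing constant.
\<close>

definition hausdorff_measure :: "real \<Rightarrow> 'a::metric_space set \<Rightarrow> ennreal" where
  "hausdorff_measure t S = (SUP \<delta>\<in>{0<..}. hausdorff_content t \<delta> S)"

end

theory Submission
  imports Defs
begin

text \<open>
  By regularity, \<open>E\<close> has about \<open>r\<^sup>-\<^sup>s\<close> points at mutual distance comparable to \<open>r\<close>, so both bounds
  reduce to showing that the level set \<open>{p. infdist p E = r}\<close> has measure comparable to \<open>r\<^sup>d\<^sup>-\<^sup>1\<close> near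
  each of them. Upper bound: a point \<open>p\<close> of the level set with nearest point \<open>q\<close> in \<open>E\<close> satisfies
  \<open>\<bar>(p - q) \<bullet> i\<bar> \<ge> r / d\<close> for some coordinate \<open>i\<close>, and for fixed \<open>i\<close> and fixed sign such points locally
  form a Lipschitz graph. Lower bound: since \<open>s < d\<close>, the set \<open>E\<close> is porous, so within distance
  \<open>K r\<close> of each \<open>x \<in> E\<close> there is a \<open>y\<close> with \<open>infdist y E \<ge> 2 r\<close>. Segments in direction \<open>y - x\<close>
  starting in the ball of radius \<open>r / 2\<close> around \<open>x\<close> all cross the level set, so this ball is covered
  by the cylinders over any cover of the level set, and a cylinder of length \<open>r\<close> over a set of
  diameter \<open>D\<close> has volume at most a constant times \<open>r D\<^sup>d\<^sup>-\<^sup>1\<close>.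
\<close>

section \<open>Regular sets and separated subsets\<close>

text \<open>A separated set of greatest cardinality is a net, since an uncovered point could be
  added to it. Cardinalities are bounded because each ball of radius \<open>e/2\<close> in a finite
  cover contains at most one point of a separated set.\<close>

lemma compact_maximal_separated:
  fixes S :: "'a::metric_space set"
  assumes "compact S" "0 < e"
  obtains Q where "finite Q" "Q \<subseteq> S" "pairwise (\<lambda>x y. e < dist x y) Q" "S \<subseteq> (\<Union>x\<in>Q. cball x e)"
proof -
  obtain F where F: "finite F" "S \<subseteq> (\<Union>x\<in>F. ball x (e/2))"
    using compact_eq_totally_bounded[THEN iffD1, OF assms(1), THEN conjunct2, rule_format, of "e/2"]
      assms(2) by auto
  define P where "P = (\<lambda>Q. Q \<subseteq> S \<and> pairwise (\<lambda>x y. e < dist x y) Q)"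
  have bound: "finite Q \<and> card Q \<le> card F" if "P Q" for Q
  proof -
    have "Q \<subseteq> (\<Union>x\<in>F. ball x (e/2))"
      using that F(2) unfolding P_def by (meson subset_trans)
    then have "\<forall>x\<in>Q. \<exists>y. y \<in> F \<and> dist y x < e/2"
      unfolding mem_ball[symmetric] by blast
    then obtain g where g: "\<forall>x\<in>Q. g x \<in> F \<and> dist (g x) x < e/2"
      by (auto simp only: bchoice_iff)
    have "inj_on g Q"
    proof
      fix x y assume xy: "x \<in> Q" "y \<in> Q" "g x = g y"
      have "dist x y < e"
        using dist_triangle_half_r[of "g x" x e y] g xy by metis
      then show "x = y"
        using that xy(1,2) unfolding P_def pairwise_def by (meson less_asym)
    qed
    moreover have "g ` Q \<subseteq> F"
      using g by auto
    ultimately show ?thesis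
      using F(1) by (simp add: card_inj_on_le inj_on_finite)
  qed
  have "P {}"
    by (simp add: P_def)
  moreover have "\<forall>Q. P Q \<longrightarrow> card Q \<le> card F"
    using bound by blast
  ultimately obtain Q where Q: "P Q" "\<And>R. P R \<Longrightarrow> card R \<le> card Q"
    using ex_has_greatest_nat[of P "{}" card "Suc (card F)"] by (auto simp: less_Suc_eq_le)
  have "x \<in> (\<Union>y\<in>Q. cball y e)" if "x \<in> S" for x
  proof (rule ccontr)
    assume "x \<notin> (\<Union>y\<in>Q. cball y e)"
    then have far: "e < dist y x" if "y \<in> Q" for y
      using that by (auto simp: not_le)
    with \<open>0 < e\<close> have "x \<notin> Q"
      by force
    moreover have "P (insert x Q)"
      using Q(1) \<open>x \<in> S\<close> far by (auto simp: P_def pairwise_insert dist_commute)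
    ultimately show False
      using Q(2)[of "insert x Q"] bound[OF Q(1)] by simp
  qed
  then have "S \<subseteq> (\<Union>x\<in>Q. cball x e)"
    by blast
  then show ?thesis
    using that[of Q] Q(1) bound[OF Q(1)] unfolding P_def by blast
qed

text \<open>Regularity in terms of a finite measure on the Borel sets of \<open>E\<close> with real
  values, so that the counting arguments can use additivity and real arithmetic.\<close>

locale regular_measure = finite_measure M for M :: "'a::euclidean_space measure" +
  fixes E :: "'a set" and s A :: real
  assumes sets_M: "sets M = sets (restrict_space borel E)"
    and compact_E: "compact E"
    and diam_pos: "0 < diameter E"
    and s_pos: "0 < s"
    and A_ge_1: "1 \<le> A"
    and measure_pos: "0 < measure M E"
    and regular: "\<And>x r. x \<in> E \<Longrightarrow> 0 < r \<Longrightarrow> r < diameter E \<Longrightarrow>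
      r powr s / A \<le> measure M (cball x r \<inter> E) \<and> measure M (cball x r \<inter> E) \<le> A * r powr s"

text \<open>Caratheodory's lemma makes \<mu> a measure on \<open>lambda_system\<close>, which
  contains the Borel sets of \<open>E\<close>.\<close>

lemma metric_measure_imp_measure:
  assumes "metric_measure E \<mu>"
  obtains M where "sets M = sets (restrict_space borel E)"
    "\<And>B. B \<in> sets M \<Longrightarrow> emeasure M B = \<mu> B"
proof -
  let ?S = "sets (restrict_space borel E)"
  let ?M = "measure_of E ?S \<mu>"
  have oms: "outer_measure_space (Pow E) \<mu>" and sub: "?S \<subseteq> lambda_system E (Pow E) \<mu>"
    using assms by (simp_all add: metric_measure_def borel_regular_outer_measure_def)
  have ms: "measure_space E (lambda_system E (Pow E) \<mu>) \<mu>"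
    using sigma_algebra.caratheodory_lemma[OF sigma_algebra_Pow oms] .
  have sp: "space (restrict_space borel E) = E"
    by (simp add: space_restrict_space)
  have sa: "sigma_algebra E ?S"
    using sets.sigma_algebra_axioms[of "restrict_space borel E"] by (simp only: sp)
  have sets: "sets ?M = ?S"
    using sigma_algebra.sets_measure_of_eq[OF sa] .
  have "emeasure ?M B = \<mu> B" if "B \<in> ?S" for B
  proof (rule emeasure_measure_of[OF refl])
    show "?S \<subseteq> Pow E"
      using sa by (simp add: sigma_algebra_iff2)
    show "positive (sets ?M) \<mu>"
      using ms by (simp add: measure_space_def positive_def)
    show "countably_additive (sets ?M) \<mu>"
    proof (rule countably_additiveI)
      fix B :: "nat \<Rightarrow> _ set" assume B: "range B \<subseteq> sets ?M" "disjoint_family B" "(\<Union>i. B i) \<in> sets ?M"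
      with sub sets have "range B \<subseteq> lambda_system E (Pow E) \<mu>" "(\<Union>i. B i) \<in> lambda_system E (Pow E) \<mu>"
        by auto
      with ms B(2) show "(\<Sum>i. \<mu> (B i)) = \<mu> (\<Union>i. B i)"
        unfolding measure_space_def countably_additive_def by blast
    qed
    show "B \<in> sets ?M"
      using that sets by simp
  qed
  with sets that[of ?M] show ?thesis
    by simp
qed

lemma regular_set_imp_regular_measure:
  fixes E :: "'a::euclidean_space set"
  assumes "compact E" "regular_set s E" "0 < s" "x \<in> E" "y \<in> E" "x \<noteq> y"
  obtains M A where "regular_measure M E s A"
proof -
  obtain \<mu> A where mu: "metric_measure E \<mu>" and A: "A \<ge> 1"
    and reg: "\<And>x r. x \<in> E \<Longrightarrow> 0 < r \<Longrightarrow> r < diameter E \<Longrightarrow>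
          ennreal (inverse A * r powr s) \<le> \<mu> (cball x r \<inter> E) \<and>
          \<mu> (cball x r \<inter> E) \<le> ennreal (A * r powr s)"
    using assms(2) unfolding regular_set_def by blast
  obtain M where M: "sets M = sets (restrict_space borel E)"
    and em: "\<And>B. B \<in> sets M \<Longrightarrow> emeasure M B = \<mu> B"
    using metric_measure_imp_measure[OF mu] by blast
  have bE: "bounded E"
    using assms(1) by (rule compact_imp_bounded)
  have sp: "space M = E"
    using sets_eq_imp_space_eq[OF M] by (simp add: space_restrict_space)
  have E: "E \<in> sets M"
    using sets.top[of M] sp by simp
  have fin: "emeasure M E < \<infinity>" and pos: "emeasure M E > 0"
    using mu bE em[OF E] by (simp_all add: metric_measure_def)
  interpret finite_measure M
    by (rule finite_measureI) (use fin in \<open>simp add: sp\<close>)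
  have "0 < dist x y"
    using assms by simp
  also have "\<dots> \<le> diameter E"
    using diameter_bounded_bound[OF bE] assms by blast
  finally have d: "0 < diameter E" .
  have "regular_measure M E s A"
  proof (unfold_locales, goal_cases)
    case 6
    show ?case
      using pos fin emeasure_eq_measure[of E] by simp
  next
    case (7 x r)
    have "cball x r \<inter> E \<in> sets M"
      unfolding M by (auto simp: sets_restrict_space)
    then have "\<mu> (cball x r \<inter> E) = ennreal (measure M (cball x r \<inter> E))"
      using em[of "cball x r \<inter> E"] emeasure_eq_measure[of "cball x r \<inter> E"] by simp
    then show ?case
      using reg[OF 7] A 7(2) by (simp add: ennreal_le_iff divide_inverse mult.commute)
  qed (use M assms d A in auto)
  then show ?thesis
    by (rule that)
qed

section \<open>Packing and covering counts in a regular set\<close>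

context regular_measure
begin

lemma cball_in_sets [measurable]: "cball x r \<inter> E \<in> sets M"
  unfolding sets_M by (auto simp: sets_restrict_space)

lemma space_M: "space M = E"
  using sets_eq_imp_space_eq[OF sets_M] by (simp add: space_restrict_space)

text \<open>Packing: the balls of radius \<rho> around the points of \<open>Q\<close> are disjoint,
  meet \<open>E\<close> inside \<open>B\<close>, and each carries mass at least
  \<open>\<rho> powr s / A\<close>.\<close>

lemma card_separated_le:
  assumes Q: "finite Q" "Q \<subseteq> E" "pairwise (\<lambda>x y. 2 * \<rho> < dist x y) Q"
    and \<rho>: "0 < \<rho>" "\<rho> < diameter E"
    and B: "B \<in> sets M" "\<And>q. q \<in> Q \<Longrightarrow> cball q \<rho> \<inter> E \<subseteq> B"
  shows "real (card Q) * \<rho> powr s \<le> A * measure M B"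
proof -
  have "disjoint_family_on (\<lambda>q. cball q \<rho> \<inter> E) Q"
    unfolding disjoint_family_on_def
  proof (intro ballI impI)
    fix p q assume "p \<in> Q" "q \<in> Q" "p \<noteq> q"
    then have "2 * \<rho> < dist p q"
      using Q(3) by (auto simp: pairwise_def)
    then have "cball p \<rho> \<inter> cball q \<rho> = {}"
      by (intro disjoint_cballI) simp
    then show "cball p \<rho> \<inter> E \<inter> (cball q \<rho> \<inter> E) = {}"
      by blast
  qed
  then have "measure M (\<Union>q\<in>Q. cball q \<rho> \<inter> E) = (\<Sum>q\<in>Q. measure M (cball q \<rho> \<inter> E))"
    using Q(1) by (intro finite_measure_finite_Union) auto
  moreover have "measure M (\<Union>q\<in>Q. cball q \<rho> \<inter> E) \<le> measure M B"
    using B by (intro finite_measure_mono) auto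
  moreover have "(\<Sum>q\<in>Q. \<rho> powr s / A) \<le> (\<Sum>q\<in>Q. measure M (cball q \<rho> \<inter> E))"
    using regular \<rho> Q(2) by (intro sum_mono) auto
  ultimately have "real (card Q) * (\<rho> powr s / A) \<le> measure M B"
    by simp
  then show ?thesis
    using A_ge_1 by (simp add: field_simps)
qed

text \<open>Covering counterpart of \<open>card_separated_le\<close>: each ball carries little mass,
  so a net must have many points.\<close>

lemma measure_le_card_cover:
  assumes Q: "finite Q" "Q \<subseteq> E" "E \<subseteq> (\<Union>q\<in>Q. cball q \<rho>)"
    and \<rho>: "0 < \<rho>" "\<rho> < diameter E"
  shows "measure M E \<le> real (card Q) * (A * \<rho> powr s)"
proof -
  have "measure M E \<le> measure M (\<Union>q\<in>Q. cball q \<rho> \<inter> E)"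
    using Q by (intro finite_measure_mono sets.finite_UN) auto
  also have "\<dots> \<le> (\<Sum>q\<in>Q. measure M (cball q \<rho> \<inter> E))"
    using Q(1) by (intro finite_measure_subadditive_finite) auto
  also have "\<dots> \<le> (\<Sum>q\<in>Q. A * \<rho> powr s)"
    using regular \<rho> Q(2) by (intro sum_mono) auto
  finally show ?thesis
    by simp
qed

end

section \<open>Upper bound\<close>

text \<open>Reduces an upper bound to counting pieces of a common size. The finite family is padded
  to a sequence by empty sets, whose gauge is \<open>0\<close> for every exponent.\<close>

lemma hausdorff_content_le_finite_cover:
  fixes U :: "'i \<Rightarrow> 'a::metric_space set"
  assumes I: "finite I" "S \<subseteq> (\<Union>k\<in>I. U k)"
    and U: "\<And>k. k \<in> I \<Longrightarrow> bounded (U k)" "\<And>k. k \<in> I \<Longrightarrow> diameter (U k) \<le> D"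
    and D: "0 < D" "D \<le> \<delta>" and t: "0 \<le> t"
  shows "hausdorff_content t \<delta> S \<le> ennreal (real (card I) * D powr t)"
proof -
  obtain h where h: "bij_betw h {..<card I} I"
    using bij_betw_from_nat_into_finite[OF I(1)] by blast
  define V where "V = (\<lambda>n. if n < card I then U (h n) else {})"
  have hI: "h n \<in> I" if "n < card I" for n
    using bij_betwE[OF h] that by blast
  have "U k \<subseteq> (\<Union>n. V n)" if k: "k \<in> I" for k
  proof -
    obtain n where "n < card I" "k = h n"
      using bij_betw_imp_surj_on[OF h] k by blast
    then have "U k = V n"
      by (simp add: V_def)
    then show ?thesis
      by blast
  qed
  then have "S \<subseteq> (\<Union>n. V n)"
    by (intro order_trans[OF I(2)] UN_least)
  moreover have "bounded (V n) \<and> diameter (V n) \<le> \<delta>" for n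
    using U[OF hI] D by (auto simp: V_def intro: order_trans)
  ultimately have "hausdorff_content t \<delta> S \<le> (\<Sum>n. hausdorff_gauge t (V n))"
    unfolding hausdorff_content_def by (intro INF_lower) auto
  also have "\<dots> = (\<Sum>n<card I. hausdorff_gauge t (V n))"
    by (intro suminf_finite) (auto simp: V_def hausdorff_gauge_def)
  also have "\<dots> \<le> (\<Sum>n<card I. ennreal (D powr t))"
  proof (intro sum_mono)
    fix n assume "n \<in> {..<card I}"
    then have "diameter (V n) \<le> D" "bounded (V n)"
      using U hI by (auto simp: V_def)
    then have "diameter (V n) powr t \<le> D powr t"
      using t by (intro powr_mono2 diameter_ge_0)
    \<comment> \<open>For \<open>t = 0\<close> a nonempty piece has gauge \<open>1\<close>, which
      equals \<open>D powr 0\<close> because \<open>D\<close> is positive.\<close>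
    then show "hausdorff_gauge t (V n) \<le> ennreal (D powr t)"
      using D by (auto simp: hausdorff_gauge_def intro: ennreal_leI)
  qed
  also have "\<dots> = ennreal (real (card I) * D powr t)"
    by (simp add: ennreal_mult ennreal_of_nat_eq_real_of_nat)
  finally show ?thesis .
qed

text \<open>If the height over the hyperplane orthogonal to \<open>i\<close> grew too steeply between \<open>p\<close> and \<open>p'\<close>,
  then \<open>p\<close> would be closer than \<open>r\<close> to \<open>q'\<close>.\<close>

lemma level_set_steepness:
  fixes p p' q' i :: "'a::euclidean_space"
  defines "d \<equiv> real DIM('a)"
  defines "w \<equiv> (p' - p) - ((p' - p) \<bullet> i) *\<^sub>R i"
  assumes i: "i \<in> Basis" and \<sigma>: "\<sigma> \<in> {1, -1::real}" and "0 < r"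
    and p: "r \<le> norm (p - q')" and p': "norm (p' - q') = r" "r / d \<le> \<sigma> * ((p' - q') \<bullet> i)"
    and above: "0 \<le> \<sigma> * ((p' - p) \<bullet> i)" and near: "\<bar>(p' - p) \<bullet> i\<bar> \<le> r / (4 * d)"
  shows "\<bar>(p' - p) \<bullet> i\<bar> \<le> 2 * d * norm w"
proof (rule ccontr)
  define u where "u = p' - q'"
  define v where "v = p' - p"
  define a where "a = v \<bullet> i"
  define \<alpha> where "\<alpha> = \<bar>a\<bar>"
  assume "\<not> ?thesis"
  then have steep: "2 * d * norm w < \<alpha>"
    by (simp add: \<alpha>_def a_def v_def)
  have d: "1 \<le> d"
    by (simp add: d_def DIM_positive Suc_leI)
  have ii: "i \<bullet> i = 1"
    using i by simp
  have v: "v = a *\<^sub>R i + w"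
    by (simp add: w_def v_def a_def)
  have iw: "i \<bullet> w = 0"
    using ii by (simp add: w_def inner_diff_right inner_commute)
  have "norm w \<le> 2 * d * norm w"
    using d mult_right_mono[of 1 "2 * d" "norm w"] by simp
  then have w: "norm w < \<alpha>"
    using steep by simp
  have \<alpha>0: "0 < \<alpha>"
    using w by (meson le_less_trans norm_ge_zero)
  have \<alpha>: "\<alpha> = \<sigma> * a" "\<sigma> * \<sigma> = 1"
    using \<sigma> above by (auto simp: \<alpha>_def a_def v_def)
  \<comment> \<open>The \<open>i\<close>-part of \<open>v\<close> contributes at least
    \<open>\<alpha> * (r / d)\<close> to \<open>u \<bullet> v\<close>. By steepness the part along
    \<open>w\<close> cancels less than half of it, and nearness keeps \<open>v \<bullet> v\<close>
    below half of it, so \<open>u - v\<close> is shorter than \<open>u\<close>.\<close>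
  have "\<alpha> * (r / d) \<le> \<alpha> * (\<sigma> * (u \<bullet> i))"
    using p'(2) \<alpha>0 by (intro mult_left_mono) (auto simp: u_def)
  also have "\<dots> = (\<sigma> * \<sigma>) * (a * (u \<bullet> i))"
    by (simp add: \<alpha>(1) mult_ac)
  also have "\<dots> = a * (u \<bullet> i)"
    by (simp add: \<alpha>(2))
  finally have main: "\<alpha> * (r / d) \<le> a * (u \<bullet> i)" .
  have "\<bar>u \<bullet> w\<bar> \<le> r * norm w"
    using Cauchy_Schwarz_ineq2[of u w] p'(1) by (simp add: u_def)
  also have "\<dots> < r * (\<alpha> / (2 * d))"
    using steep d \<open>0 < r\<close> by (intro mult_strict_left_mono) (auto simp: field_simps)
  finally have "- (\<alpha> * (r / d) / 2) < u \<bullet> w"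
    by (simp add: field_simps)
  with main have uv: "\<alpha> * (r / d) / 2 < u \<bullet> v"
    by (simp add: v inner_add_right)
  have "v \<bullet> v = a\<^sup>2 + (norm w)\<^sup>2"
    unfolding power2_norm_eq_inner using ii iw
    by (simp add: v inner_add_left inner_add_right inner_commute[of w i] power2_eq_square)
  also have "\<dots> \<le> \<alpha>\<^sup>2 + \<alpha>\<^sup>2"
    using power_mono[of "norm w" \<alpha> 2] w by (simp add: \<alpha>_def)
  also have "\<dots> \<le> 2 * \<alpha> * (r / (4 * d))"
    using mult_left_mono[of \<alpha> "r / (4 * d)" "2 * \<alpha>"] near \<alpha>0
    unfolding \<alpha>_def a_def v_def power2_eq_square by linarith
  finally have vv: "v \<bullet> v \<le> \<alpha> * (r / d) / 2"
    by simp
  have "(norm (p - q'))\<^sup>2 = (u - v) \<bullet> (u - v)"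
    by (simp add: u_def v_def power2_norm_eq_inner)
  also have "\<dots> = u \<bullet> u - 2 * (u \<bullet> v) + v \<bullet> v"
    by (simp add: inner_diff_left inner_diff_right inner_commute)
  also have "\<dots> < r\<^sup>2"
  proof -
    define t where "t = \<alpha> * (r / d)"
    have "0 < t"
      using \<alpha>0 \<open>0 < r\<close> d by (simp add: t_def)
    moreover have "u \<bullet> u = r\<^sup>2"
      using p'(1) by (simp add: u_def power2_norm_eq_inner[symmetric])
    ultimately show ?thesis
      using uv vv unfolding t_def[symmetric] by linarith
  qed
  finally show False
    using p \<open>0 < r\<close> by (meson not_less power_mono less_imp_le)
qed

text \<open>By the steepness bound, the points of the level set whose direction to a nearest point has a
  large component along \<open>\<sigma> i\<close> locally form a Lipschitz graph over the hyperplane orthogonal to \<open>i\<close>;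
  hence the mesh \<open>r / n\<close> is needed in the other directions only.\<close>

definition level_cell :: "'a::euclidean_space set \<Rightarrow> real \<Rightarrow> nat \<Rightarrow> 'a \<times> 'a \<times> real \<Rightarrow> ('a \<Rightarrow> int) \<Rightarrow> 'a set" where
  "level_cell E r n = (\<lambda>(x, i, \<sigma>) f. {p. infdist p E = r \<and>
     (\<exists>q\<in>E. dist p q = r \<and> r / real DIM('a) \<le> \<sigma> * ((p - q) \<bullet> i)) \<and>
     (\<forall>b\<in>Basis. \<lfloor>(p - x) \<bullet> b / (if b = i then r / (4 * real DIM('a)) else r / real n)\<rfloor> = f b)})"

text \<open>The floors confine the components other than \<open>i\<close> to the mesh
  \<open>r / n\<close>, and steepness transfers this to the component along \<open>i\<close>. The
  coarse mesh \<open>r / (4 * d)\<close> in direction \<open>i\<close> supplies the nearness that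
  \<open>level_set_steepness\<close> asks for.\<close>

lemma level_cell_dist:
  fixes x i :: "'a::euclidean_space"
  defines "d \<equiv> real DIM('a)"
  assumes i: "i \<in> Basis" and \<sigma>: "\<sigma> \<in> {1, -1}" and "0 < r" "0 < n"
    and p: "p \<in> level_cell E r n (x, i, \<sigma>) f" and p': "p' \<in> level_cell E r n (x, i, \<sigma>) f"
  shows "dist p p' \<le> 3 * d\<^sup>2 * r / real n"
proof -
  define h where "h = r / real n"
  have h: "0 < h"
    using assms by (simp add: h_def)
  have d: "1 \<le> d"
    by (simp add: d_def DIM_positive Suc_leI)
  have floor_near: "\<bar>a - b\<bar> \<le> e" if "\<lfloor>a / e\<rfloor> = \<lfloor>b / e\<rfloor>" "0 < e" for a b e :: real
  proof -
    have "\<bar>a / e - b / e\<bar> < 1"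
      using that(1) by linarith
    then have "\<bar>a - b\<bar> / e < 1"
      using that(2) by (simp add: diff_divide_distrib[symmetric])
    then show ?thesis
      using that(2) by (simp add: field_simps)
  qed
  have coord: "\<bar>(p' - p) \<bullet> b\<bar> \<le> (if b = i then r / (4 * d) else h)" if "b \<in> Basis" for b
  proof -
    let ?e = "if b = i then r / (4 * d) else h"
    have "\<lfloor>(p' - x) \<bullet> b / ?e\<rfloor> = \<lfloor>(p - x) \<bullet> b / ?e\<rfloor>"
      using p p' that unfolding level_cell_def prod.case mem_Collect_eq d_def h_def by metis
    moreover have "0 < ?e"
      using h d \<open>0 < r\<close> by simp
    ultimately have "\<bar>(p' - x) \<bullet> b - (p - x) \<bullet> b\<bar> \<le> ?e"
      by (rule floor_near)
    then show ?thesis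
      by (simp add: inner_diff_left)
  qed
  define w where "w = (p' - p) - ((p' - p) \<bullet> i) *\<^sub>R i"
  have "norm w \<le> (\<Sum>b\<in>Basis. \<bar>w \<bullet> b\<bar>)"
    by (rule norm_le_l1)
  also have "\<dots> \<le> (\<Sum>b\<in>(Basis::'a set). h)"
  proof (rule sum_mono)
    fix b :: 'a assume b: "b \<in> Basis"
    show "\<bar>w \<bullet> b\<bar> \<le> h"
    proof (cases "b = i")
      case True
      then show ?thesis
        using i h by (simp add: w_def inner_diff_left)
    next
      case False
      then show ?thesis
        using coord[OF b] i b by (simp add: w_def inner_diff_left inner_not_same_Basis)
    qed
  qed
  finally have w: "norm w \<le> d * h"
    by (simp add: d_def)
  have near: "\<bar>(p' - p) \<bullet> i\<bar> \<le> r / (4 * d)" "\<bar>(p - p') \<bullet> i\<bar> \<le> r / (4 * d)"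
    using coord[OF i] by (simp_all add: inner_diff_left abs_minus_commute)
  \<comment> \<open>The point that is higher in direction \<open>\<sigma> *\<^sub>R i\<close> takes
    the role of \<open>p'\<close>, together with its own nearest point.\<close>
  have "\<bar>(p' - p) \<bullet> i\<bar> \<le> 2 * d * norm w"
  proof (cases "0 \<le> \<sigma> * ((p' - p) \<bullet> i)")
    case True
    obtain q' where q': "q' \<in> E" "norm (p' - q') = r" "r / d \<le> \<sigma> * ((p' - q') \<bullet> i)"
      using p' by (auto simp: level_cell_def d_def dist_norm)
    have "r \<le> norm (p - q')"
      using p infdist_le[OF q'(1), of p] by (simp add: level_cell_def dist_norm)
    then show ?thesis
      using level_set_steepness[OF i \<sigma> \<open>0 < r\<close>, of p q' p'] q' True near by (simp add: d_def w_def)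
  next
    case False
    obtain q where q: "q \<in> E" "norm (p - q) = r" "r / d \<le> \<sigma> * ((p - q) \<bullet> i)"
      using p by (auto simp: level_cell_def d_def dist_norm)
    have "r \<le> norm (p' - q)"
      using p' infdist_le[OF q(1), of p'] by (simp add: level_cell_def dist_norm)
    moreover have "0 \<le> \<sigma> * ((p - p') \<bullet> i)"
      using False by (simp add: inner_diff_left right_diff_distrib)
    moreover have "p - p' - ((p - p') \<bullet> i) *\<^sub>R i = - w"
      by (simp add: w_def inner_diff_left scaleR_left_diff_distrib)
    ultimately show ?thesis
      using level_set_steepness[OF i \<sigma> \<open>0 < r\<close>, of p' q p] q near
      by (simp add: d_def inner_diff_left abs_minus_commute)
  qed
  also have "\<dots> \<le> 2 * d * (d * h)"
    using w d by (intro mult_left_mono) auto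
  finally have a: "\<bar>(p' - p) \<bullet> i\<bar> \<le> 2 * d\<^sup>2 * h"
    by (simp add: power2_eq_square)
  have "dist p p' = norm (((p' - p) \<bullet> i) *\<^sub>R i + w)"
    by (simp add: w_def dist_norm norm_minus_commute)
  also have "\<dots> \<le> \<bar>(p' - p) \<bullet> i\<bar> + norm w"
    using norm_triangle_ineq[of "((p' - p) \<bullet> i) *\<^sub>R i" w] i by simp
  also have "\<dots> \<le> 2 * d\<^sup>2 * h + d * h"
    using a w by linarith
  also have "d * h \<le> d\<^sup>2 * h"
    using d h by (simp add: power2_eq_square)
  finally show ?thesis
    by (simp add: h_def mult_ac)
qed

lemma level_cell_bounded:
  fixes x i :: "'a::euclidean_space"
  assumes "i \<in> Basis" "\<sigma> \<in> {1, -1}" "0 < r" "0 < n"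
  shows "bounded (level_cell E r n (x, i, \<sigma>) f)"
    and "diameter (level_cell E r n (x, i, \<sigma>) f) \<le> 3 * (real DIM('a))\<^sup>2 * r / real n"
proof -
  show "bounded (level_cell E r n (x, i, \<sigma>) f)"
    unfolding bounded_two_points using level_cell_dist[OF assms] 
    by blast
  show "diameter (level_cell E r n (x, i, \<sigma>) f) \<le> 3 * (real DIM('a))\<^sup>2 * r / real n"
    using level_cell_dist[OF assms] assms by (intro diameter_le) (auto simp: dist_norm)
qed

lemma floor_mem_interval:
  fixes a e :: real
  assumes "\<bar>a\<bar> \<le> real m * e" "0 < e"
  shows "\<lfloor>a / e\<rfloor> \<in> {- int m..int m}"
proof -
  have "- real m \<le> a / e" "a / e \<le> real m"
    using assms by (auto simp: field_simps abs_le_iff)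
  then show ?thesis
    by (auto simp: le_floor_iff floor_le_iff)
qed

text \<open>Pigeonhole: the absolute values of the coordinates sum to at least
  \<open>norm u\<close>.\<close>

lemma exists_large_coordinate:
  fixes u :: "'a::euclidean_space"
  obtains i \<sigma> where "i \<in> Basis" "\<sigma> \<in> {1, -1::real}" "norm u / real DIM('a) \<le> \<sigma> * (u \<bullet> i)"
proof -
  have "\<exists>i\<in>Basis. norm u / real DIM('a) \<le> \<bar>u \<bullet> i\<bar>"
  proof (rule ccontr)
    assume "\<not> ?thesis"
    then have "(\<Sum>b\<in>Basis. \<bar>u \<bullet> b\<bar>) < (\<Sum>b\<in>(Basis::'a set). norm u / real DIM('a))"
      by (intro sum_strict_mono) (auto simp: not_le)
    then show False
      using norm_le_l1[of u] by simp
  qed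
  then obtain i where i: "i \<in> Basis" "norm u / real DIM('a) \<le> \<bar>u \<bullet> i\<bar>"
    by blast
  show ?thesis
    using that[of i 1] that[of i "-1"] i by (cases "0 \<le> u \<bullet> i") auto
qed

text \<open>For each centre in \<open>Q\<close>, direction and sign, about
  \<open>n ^ (d - 1)\<close> cells of diameter about \<open>r / n\<close> suffice, and
  \<open>n\<close> is free to grow as \<delta> shrinks.\<close>

lemma hausdorff_measure_level_set_le:
  fixes E :: "'a::euclidean_space set"
  defines "d \<equiv> DIM('a)"
  assumes E: "closed E" "E \<noteq> {}" and Q: "finite Q" "E \<subseteq> (\<Union>x\<in>Q. cball x r)" and "0 < r"
  shows "hausdorff_measure (real d - 1) {p. infdist p E = r}
    \<le> ennreal (34 * real d ^ 2 * (15 * real d ^ 2) ^ (d - 1) * real (card Q) * r powr (real d - 1))"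
proof -
  have d: "1 \<le> d"
    by (simp add: d_def DIM_positive Suc_leI)
  let ?S = "{p. infdist p E = r}"
  define K where "K = 34 * real d ^ 2 * (15 * real d ^ 2) ^ (d - 1) * real (card Q) * r powr (real d - 1)"
  have "hausdorff_content (real d - 1) \<delta> ?S \<le> ennreal K" if "0 < \<delta>" for \<delta>
  proof -
    define c where "c = 3 * (real d)\<^sup>2 * r"
    have c: "0 < c"
      using \<open>0 < r\<close> d by (simp add: c_def)
    obtain n where n: "c / \<delta> < real n"
      using reals_Archimedean2 by blast
    have n0: "0 < n"
      using n c that by (cases n) (auto simp: divide_less_0_iff not_less)
    \<comment> \<open>Points of the level set assigned to \<open>x\<close> lie within
      \<open>2 * r\<close> of it; dividing by the meshes \<open>r / (4 * d)\<close> and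
      \<open>r / n\<close> gives these index ranges.\<close>
    define m where "m = (\<lambda>(i::'a) b. if b = i then 8 * d else 2 * n)"
    define J where "J = (\<lambda>(x::'a, i, \<sigma>::real). PiE (Basis::'a set) (\<lambda>b. {- int (m i b)..int (m i b)}))"
    define T where "T = Q \<times> (Basis::'a set) \<times> {1, -1::real}"
    define I where "I = Sigma T J"
    define U where "U = (\<lambda>(k, f). level_cell E r n k f)"
    have finT: "finite T"
      using Q by (simp add: T_def)
    have finJ: "finite (J k)" for k
      by (auto simp: J_def split: prod.splits intro!: finite_PiE)
    have cover: "?S \<subseteq> (\<Union>k\<in>I. U k)"
    proof
      fix p assume "p \<in> ?S"
      then have p: "infdist p E = r"
        by simp
      obtain q where q: "q \<in> E" "dist p q = r"
        using infdist_attains_inf[OF E, of p] p by metis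
      obtain x where x: "x \<in> Q" "dist x q \<le> r"
        using Q(2) q(1) by auto
      obtain i \<sigma> where i: "i \<in> Basis" "\<sigma> \<in> {1, -1}" "r / real d \<le> \<sigma> * ((p - q) \<bullet> i)"
        using exists_large_coordinate[of "p - q"] q(2) by (metis dist_norm d_def)
      have px: "norm (p - x) \<le> 2 * r"
        using dist_triangle[of p x q] x q(2) by (simp add: dist_norm norm_minus_commute)
      let ?e = "\<lambda>b. if b = i then r / (4 * real d) else r / real n"
      let ?f = "restrict (\<lambda>b. \<lfloor>(p - x) \<bullet> b / ?e b\<rfloor>) Basis"
      have "\<lfloor>(p - x) \<bullet> b / ?e b\<rfloor> \<in> {- int (m i b)..int (m i b)}" if "b \<in> Basis" for b
      proof (rule floor_mem_interval)
        have "real (m i b) * ?e b = 2 * r"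
          using d n0 by (simp add: m_def)
        then show "\<bar>(p - x) \<bullet> b\<bar> \<le> real (m i b) * ?e b"
          using Basis_le_norm[OF that, of "p - x"] px by linarith
        show "0 < ?e b"
          using \<open>0 < r\<close> d n0 by simp
      qed
      then have "?f \<in> J (x, i, \<sigma>)"
        by (auto simp: J_def)
      then have "((x, i, \<sigma>), ?f) \<in> I"
        using x i by (simp add: I_def T_def)
      moreover have "p \<in> U ((x, i, \<sigma>), ?f)"
        using p q i by (auto simp: U_def level_cell_def d_def)
      ultimately show "p \<in> (\<Union>k\<in>I. U k)"
        by blast
    qed
    \<comment> \<open>A coordinate takes \<open>2 * m i b + 1\<close> values: at most
      \<open>17 * d\<close> in direction \<open>i\<close> and \<open>5 * n\<close> in each other
      direction.\<close>
    have "card (J k) \<le> 17 * d * (5 * n) ^ (d - 1)" if "k \<in> T" for k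
    proof -
      obtain x i \<sigma> where k: "k = (x, i, \<sigma>)" "i \<in> Basis"
        using \<open>k \<in> T\<close> by (auto simp: T_def)
      have "card (J k) = (\<Prod>b\<in>Basis. 2 * m i b + 1)"
        by (simp add: J_def k card_PiE nat_add_distrib nat_mult_distrib)
      also have "\<dots> = (2 * m i i + 1) * (\<Prod>b\<in>Basis - {i}. 2 * m i b + 1)"
        using k(2) by (intro prod.remove) auto
      also have "(\<Prod>b\<in>Basis - {i}. 2 * m i b + 1) = (\<Prod>b\<in>Basis - {i}. 4 * n + 1)"
        by (intro prod.cong) (auto simp: m_def)
      also have "\<dots> = (4 * n + 1) ^ (d - 1)"
        using k(2) by (simp add: d_def card_Diff_singleton)
      also have "(2 * m i i + 1) * (4 * n + 1) ^ (d - 1) \<le> 17 * d * (5 * n) ^ (d - 1)"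
        using d n0 by (intro mult_le_mono power_mono) (auto simp: m_def)
      finally show ?thesis .
    qed
    moreover have "card I = (\<Sum>k\<in>T. card (J k))"
      unfolding I_def using finT finJ by (intro card_SigmaI) auto
    ultimately have "card I \<le> (\<Sum>k\<in>T. 17 * d * (5 * n) ^ (d - 1))"
      by (metis sum_mono)
    also have "\<dots> = card Q * d * 2 * (17 * d * (5 * n) ^ (d - 1))"
      by (simp add: T_def card_cartesian_product d_def)
    finally have "real (card I) \<le> real (card Q * d * 2 * (17 * d * (5 * n) ^ (d - 1)))"
      by (rule of_nat_mono)
    then have cardI: "real (card I) \<le> 34 * real d ^ 2 * real (card Q) * (5 * real n) ^ (d - 1)"
      by (simp add: power2_eq_square mult_ac)
    have "hausdorff_content (real d - 1) \<delta> ?S \<le> ennreal (real (card I) * (c / n) powr (real d - 1))"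
    proof (rule hausdorff_content_le_finite_cover[OF _ cover])
      show "finite I"
        by (simp add: I_def finT finJ finite_SigmaI)
      show "0 < c / n" "0 \<le> real d - 1"
        using c n0 d by auto
      show "c / n \<le> \<delta>"
        using n n0 that by (simp add: field_simps)
      fix k assume "k \<in> I"
      then show "bounded (U k)" "diameter (U k) \<le> c / n"
        using level_cell_bounded[OF _ _ \<open>0 < r\<close> n0, where E = E]
        by (auto simp: I_def T_def U_def c_def d_def)
    qed
    also have "\<dots> \<le> ennreal K"
    proof (rule ennreal_leI)
      have pw: "y powr (real d - 1) = y ^ (d - 1)" if "0 < y" for y
        using that d powr_realpow[of y "d - 1"] by (simp add: of_nat_diff)
      have "real (card I) * (c / n) powr (real d - 1)
          \<le> 34 * real d ^ 2 * real (card Q) * (5 * real n) ^ (d - 1) * (c / n) ^ (d - 1)"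
        using cardI c n0 by (simp add: pw mult_right_mono)
      \<comment> \<open>Here \<open>n\<close> cancels, so the bound is independent of
        \<delta>.\<close>
      also have "\<dots> = 34 * real d ^ 2 * real (card Q) * (5 * real n * (c / n)) ^ (d - 1)"
        by (simp only: power_mult_distrib mult.assoc)
      also have "5 * real n * (c / n) = 15 * real d ^ 2 * r"
        using n0 by (simp add: c_def)
      also have "34 * real d ^ 2 * real (card Q) * (15 * real d ^ 2 * r) ^ (d - 1) = K"
        using \<open>0 < r\<close> by (simp add: K_def pw power_mult_distrib)
      finally show "real (card I) * (c / n) powr (real d - 1) \<le> K" .
    qed
    finally show ?thesis .
  qed
  then show ?thesis
    unfolding hausdorff_measure_def K_def by (intro SUP_least) auto
qed

section \<open>Lower bound\<close>

text \<open>Two points of the cylinder inside the ball differ by a multiple of \<open>u\<close> of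
  length at most \<open>r + D\<close> and an error of norm at most \<open>D\<close>. Hence about
  \<open>r / D\<close> balls of radius \<open>2 * D\<close>, strung along the line through
  \<open>a\<close>, cover it.\<close>

lemma thin_cylinder_cover:
  fixes U :: "'a::euclidean_space set"
  defines "d \<equiv> DIM('a)"
  assumes U: "bounded U" "diameter U \<le> D" and D: "0 < D" "D \<le> r"
  obtains W where "W \<in> sets borel" "{z \<in> cball x (r / 2). \<exists>\<tau>. z + \<tau> *\<^sub>R u \<in> U} \<subseteq> W"
    "emeasure lborel W \<le> ennreal (9 * 2 ^ d * unit_ball_vol d * r * D ^ (d - 1))"
proof (cases "{z \<in> cball x (r / 2). \<exists>\<tau>. z + \<tau> *\<^sub>R u \<in> U} = {}")
  case True
  then show ?thesis
    by (intro that[of "{}"]) auto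
next
  case False
  then obtain a \<tau>\<^sub>0 where a: "a \<in> cball x (r / 2)" "a + \<tau>\<^sub>0 *\<^sub>R u \<in> U"
    by blast
  \<comment> \<open>The position along the line, in units of \<open>D\<close>, is at most
    \<open>r / D + 1\<close> in absolute value; rounding down costs one more.\<close>
  define m where "m = \<lceil>r / D\<rceil> + 2"
  define W where "W = (\<Union>k\<in>{-m..m}. cball (a + (of_int k * D) *\<^sub>R sgn u) (2 * D))"
  have d: "1 \<le> d"
    by (simp add: d_def DIM_positive Suc_leI)
  have rD: "1 \<le> r / D"
    using D by simp
  have m: "of_int m \<le> r / D + 3" "r / D + 2 \<le> of_int m"
    by (simp_all add: m_def) linarith
  show ?thesis
  proof (rule that)
    show "W \<in> sets borel"
      by (auto simp: W_def)
    show "{z \<in> cball x (r / 2). \<exists>\<tau>. z + \<tau> *\<^sub>R u \<in> U} \<subseteq> W"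
    proof safe
      fix b \<tau> assume b: "b \<in> cball x (r / 2)" "b + \<tau> *\<^sub>R u \<in> U"
      define e where "e = (b + \<tau> *\<^sub>R u) - (a + \<tau>\<^sub>0 *\<^sub>R u)"
      define t where "t = (\<tau>\<^sub>0 - \<tau>) * norm u"
      have "dist (b + \<tau> *\<^sub>R u) (a + \<tau>\<^sub>0 *\<^sub>R u) \<le> D"
        using diameter_bounded_bound[OF U(1) b(2) a(2)] U(2) by simp
      then have e: "norm e \<le> D"
        by (simp add: e_def dist_norm)
      \<comment> \<open>For \<open>u = 0\<close> both \<open>sgn u\<close> and \<open>t\<close>
        vanish, so the decomposition below remains valid.\<close>
      have "t *\<^sub>R sgn u = (\<tau>\<^sub>0 - \<tau>) *\<^sub>R u"
        by (cases "u = 0") (simp_all add: t_def sgn_div_norm)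
      then have ba: "b = a + t *\<^sub>R sgn u + e"
        by (simp add: e_def algebra_simps)
      have "\<bar>t\<bar> = norm (t *\<^sub>R sgn u)"
        by (simp add: t_def norm_sgn)
      also have "t *\<^sub>R sgn u = (b - a) - e"
        by (simp add: ba)
      also have "norm \<dots> \<le> norm (b - a) + norm e"
        by (rule norm_triangle_ineq4)
      also have "norm (b - a) \<le> r"
        using a(1) b(1) dist_triangle2[of b a x] by (simp add: dist_norm norm_minus_commute)
      finally have "\<bar>t\<bar> \<le> r + D"
        using e by simp
      then have "\<bar>t\<bar> / D \<le> (r + D) / D"
        using D by (intro divide_right_mono) auto
      then have t: "\<bar>t / D\<bar> \<le> r / D + 1"
        using D by (simp add: add_divide_distrib)
      define k where "k = \<lfloor>t / D\<rfloor>"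
      have k: "k \<in> {-m..m}"
        using t m(2) unfolding k_def by (auto simp: abs_le_iff; linarith)
      have "\<bar>t / D - of_int k\<bar> \<le> 1"
        unfolding k_def by linarith
      then have "\<bar>t / D - of_int k\<bar> * D \<le> D"
        using D by simp
      also have "\<bar>t / D - of_int k\<bar> * D = \<bar>(t / D - of_int k) * D\<bar>"
        using D by (simp add: abs_mult)
      also have "(t / D - of_int k) * D = t - of_int k * D"
        using D by (simp add: left_diff_distrib)
      finally have tk: "\<bar>t - of_int k * D\<bar> \<le> D" .
      have "norm (b - (a + (of_int k * D) *\<^sub>R sgn u)) = norm ((t - of_int k * D) *\<^sub>R sgn u + e)"
        by (simp add: ba algebra_simps)
      also have "\<dots> \<le> \<bar>t - of_int k * D\<bar> * norm (sgn u) + norm e"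
        using norm_triangle_ineq[of "(t - of_int k * D) *\<^sub>R sgn u" e] by simp
      also have "\<dots> \<le> \<bar>t - of_int k * D\<bar> * 1 + norm e"
        by (intro add_mono mult_left_mono) (auto simp: norm_sgn)
      also have "\<dots> \<le> 2 * D"
        using tk e by simp
      finally show "b \<in> W"
        using k by (auto simp: W_def dist_norm norm_minus_commute intro!: bexI[of _ k])
    qed
    have "emeasure lborel W
        \<le> (\<Sum>k\<in>{-m..m}. emeasure lborel (cball (a + (of_int k * D) *\<^sub>R sgn u) (2 * D)))"
      unfolding W_def by (intro emeasure_subadditive_finite) auto
    also have "\<dots> = (\<Sum>k\<in>{-m..m}. ennreal (unit_ball_vol d * (2 * D) ^ d))"
      using D by (simp add: emeasure_cball d_def)
    also have "\<dots> = ennreal (real (nat (2 * m + 1)) * (unit_ball_vol d * (2 * D) ^ d))"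
      using D by (simp add: ennreal_mult ennreal_of_nat_eq_real_of_nat algebra_simps)
    also have "\<dots> \<le> ennreal (9 * 2 ^ d * unit_ball_vol d * r * D ^ (d - 1))"
    proof (rule ennreal_leI)
      define x where "x = D ^ (d - 1)"
      have pw: "(2 * D) ^ d = 2 ^ d * (D * x)"
        using d power_Suc[of D "d - 1"] by (simp add: power_mult_distrib x_def)
      \<comment> \<open>There are at most \<open>2 * (r / D) + 7\<close> balls, and
        \<open>r / D \<ge> 1\<close> absorbs the constant into the factor \<open>9\<close>.\<close>
      have "real (nat (2 * m + 1)) = 2 * of_int m + 1"
        using m rD by (subst of_nat_nat) auto
      also have "\<dots> \<le> 9 * (r / D)"
        using m rD by linarith
      finally have "real (nat (2 * m + 1)) * (unit_ball_vol d * (2 * D) ^ d)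
          \<le> 9 * (r / D) * (unit_ball_vol d * (2 * D) ^ d)"
        using D by (intro mult_right_mono) auto
      also have "9 * (r / D) * (unit_ball_vol d * (2 * D) ^ d)
          = 9 * 2 ^ d * unit_ball_vol d * r * D ^ (d - 1)"
        unfolding pw x_def[symmetric] using D by simp
      finally show "real (nat (2 * m + 1)) * (unit_ball_vol d * (2 * D) ^ d)
          \<le> 9 * 2 ^ d * unit_ball_vol d * r * D ^ (d - 1)" .
    qed
    finally show "emeasure lborel W \<le> ennreal (9 * 2 ^ d * unit_ball_vol d * r * D ^ (d - 1))" .
  qed
qed

text \<open>Choosing \<open>D\<close> as the diameter of \<open>U\<close> turns the factor
  \<open>D ^ (d - 1)\<close> into the gauge; the degenerate cases need other choices.\<close>

lemma cylinder_cover: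
  fixes U :: "'a::euclidean_space set"
  defines "d \<equiv> DIM('a)"
  assumes U: "bounded U" "diameter U \<le> r" and r: "0 < r"
  obtains W where "W \<in> sets borel" "{z \<in> cball x (r / 2). \<exists>\<tau>. z + \<tau> *\<^sub>R u \<in> U} \<subseteq> W"
    "emeasure lborel W \<le> ennreal (9 * 2 ^ d * unit_ball_vol d * r) * hausdorff_gauge (real d - 1) U"
proof -
  have d: "1 \<le> d"
    by (simp add: d_def DIM_positive Suc_leI)
  define V where "V = {z \<in> cball x (r / 2). \<exists>\<tau>. z + \<tau> *\<^sub>R u \<in> U}"
  define C where "C = 9 * 2 ^ d * unit_ball_vol d * r"
  have C: "0 < C"
    using r by (simp add: C_def)
  have cover: "\<exists>W. W \<in> sets borel \<and> V \<subseteq> W \<and> emeasure lborel W \<le> ennreal (C * D ^ (d - 1))"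
    if "diameter U \<le> D" "0 < D" "D \<le> r" for D
    by (rule thin_cylinder_cover[OF U(1) that, of x u, folded d_def, folded V_def C_def]) blast
  consider "U = {}" | "U \<noteq> {}" "d = 1" | "U \<noteq> {}" "2 \<le> d" "0 < diameter U"
    | "U \<noteq> {}" "2 \<le> d" "diameter U = 0"
    using d diameter_ge_0[OF U(1)] by linarith
  then have "\<exists>W. W \<in> sets borel \<and> V \<subseteq> W \<and> emeasure lborel W \<le> ennreal C * hausdorff_gauge (real d - 1) U"
  proof cases
    case 1
    then show ?thesis
      by (intro exI[of _ "{}"]) (auto simp: V_def)
  next
    \<comment> \<open>In dimension one the gauge of a nonempty set is \<open>1\<close> whatever its
      diameter, so \<open>D = r\<close> is enough.\<close>
    case 2
    then show ?thesis
      using cover[OF U(2) r order_refl] by (simp add: hausdorff_gauge_def)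
  next
    case 3
    then have "hausdorff_gauge (real d - 1) U = ennreal (diameter U ^ (d - 1))"
      using powr_realpow[of "diameter U" "d - 1"] by (simp add: hausdorff_gauge_def of_nat_diff)
    then show ?thesis
      using cover[OF order_refl 3(3) U(2)] C 3(3) by (simp add: ennreal_mult)
  next
    \<comment> \<open>The gauge is now zero, so a null cover is required: the covers for
      \<open>D = r / (n + 1)\<close> are intersected.\<close>
    case 4
    define D where "D = (\<lambda>n. r / real (Suc n))"
    have "\<exists>W. W \<in> sets borel \<and> V \<subseteq> W \<and> emeasure lborel W \<le> ennreal (C * D n ^ (d - 1))" for n
      using r 4 by (intro cover) (auto simp: D_def field_simps)
    then obtain W where W: "\<And>n. W n \<in> sets borel" "\<And>n. V \<subseteq> W n"
        "\<And>n. emeasure lborel (W n) \<le> ennreal (C * D n ^ (d - 1))"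
      by metis
    have "D \<longlonglongrightarrow> 0"
      unfolding D_def by (rule LIMSEQ_Suc[OF lim_const_over_n])
    then have "(\<lambda>n. C * D n ^ (d - 1)) \<longlonglongrightarrow> C * 0 ^ (d - 1)"
      by (intro tendsto_intros)
    then have "(\<lambda>n. ennreal (C * D n ^ (d - 1))) \<longlonglongrightarrow> ennreal (C * 0 ^ (d - 1))"
      by (rule tendsto_ennrealI)
    moreover have "emeasure lborel (\<Inter>n. W n) \<le> ennreal (C * D n ^ (d - 1))" for n
    proof -
      have "emeasure lborel (\<Inter>n. W n) \<le> emeasure lborel (W n)"
        using W(1) by (intro emeasure_mono) auto
      then show ?thesis
        using W(3)[of n] by (rule order_trans)
    qed
    ultimately have "emeasure lborel (\<Inter>n. W n) \<le> ennreal (C * 0 ^ (d - 1))"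
      by (intro LIMSEQ_le_const) auto
    then show ?thesis
      using W(1,2) 4 by (intro exI[of _ "\<Inter>n. W n"]) (auto simp: power_0_left)
  qed
  then show ?thesis
    using that unfolding V_def C_def by blast
qed

section \<open>Paths crossing the level set and the volume they sweep\<close>

lemma level_set_crossing:
  fixes z u :: "'a::euclidean_space"
  assumes "infdist z E \<le> r" "r \<le> infdist (z + u) E"
  obtains \<tau> where "0 \<le> \<tau>" "\<tau> \<le> 1" "infdist (z + \<tau> *\<^sub>R u) E = r"
proof -
  have "continuous_on {0..1} (\<lambda>\<tau>. infdist (z + \<tau> *\<^sub>R u) E)"
    by (intro continuous_intros)
  then show ?thesis
    using IVT'[of "\<lambda>\<tau>. infdist (z + \<tau> *\<^sub>R u) E" 0 r 1] assms that by auto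
qed

text \<open>The ball around \<open>q\<close> is translated into the hole around \<open>y q\<close>, so that the path of each of its
  points crosses the level set. The centres are so far apart that a small set \<open>U\<close> is met by the
  paths of at most one ball, whence the volume of all balls together is controlled by the cylinders
  over the members of a cover.\<close>

lemma hausdorff_measure_level_set_ge:
  fixes E :: "'a::euclidean_space set" and y :: "'a \<Rightarrow> 'a"
  defines "d \<equiv> DIM('a)"
  assumes Q: "finite Q" "Q \<subseteq> E" "pairwise (\<lambda>p q. (2 * K + 4) * r < dist p q) Q"
    and r: "0 < r" and K: "0 \<le> K"
    and y: "\<And>q. q \<in> Q \<Longrightarrow> norm (y q - q) \<le> K * r" "\<And>q. q \<in> Q \<Longrightarrow> 2 * r \<le> infdist (y q) E"
  shows "ennreal (real (card Q) * r powr (real d - 1) / (9 * 4 ^ d))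
    \<le> hausdorff_measure (real d - 1) {p. infdist p E = r}"
proof -
  let ?S = "{p. infdist p E = r}"
  have d: "1 \<le> d"
    by (simp add: d_def DIM_positive Suc_leI)
  define C where "C = 9 * 2 ^ d * unit_ball_vol d * r"
  have C: "0 < C"
    using r by (simp add: C_def)
  define X where "X = real (card Q) * r powr (real d - 1) / (9 * 4 ^ d)"
  have "ennreal X \<le> (\<Sum>i. hausdorff_gauge (real d - 1) (U i))"
    if U: "?S \<subseteq> (\<Union>i. U i)" "\<And>i. bounded (U i)" "\<And>i. diameter (U i) \<le> r" for U :: "nat \<Rightarrow> 'a set"
  proof -
    \<comment> \<open>\<open>P q z i\<close> says that the path of \<open>z\<close>, starting in the
      ball around \<open>q\<close>, meets \<open>U i\<close>.\<close>
    define P where "P = (\<lambda>q z i. q \<in> Q \<and> z \<in> cball q (r / 2) \<and>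
      (\<exists>\<tau>\<ge>0. \<tau> \<le> 1 \<and> z + \<tau> *\<^sub>R (y q - q) \<in> U i))"
    have P_unique: "p = q" if pq: "P p z i" "P q z' i" for p q z z' i
    proof -
      have near: "\<exists>w\<in>U i. dist w q \<le> K * r + r / 2" if Pq: "P q z i" for q z
      proof -
        obtain \<tau> where \<tau>: "0 \<le> \<tau>" "\<tau> \<le> 1" "z + \<tau> *\<^sub>R (y q - q) \<in> U i"
          using Pq by (auto simp: P_def)
        have "dist (z + \<tau> *\<^sub>R (y q - q)) q \<le> norm (z - q) + norm (\<tau> *\<^sub>R (y q - q))"
          unfolding dist_norm using norm_triangle_ineq[of "z - q" "\<tau> *\<^sub>R (y q - q)"]
          by (simp add: algebra_simps)
        also have "norm (\<tau> *\<^sub>R (y q - q)) \<le> 1 * (K * r)"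
          using \<tau> y(1)[of q] Pq unfolding norm_scaleR P_def by (intro mult_mono) auto
        also have "norm (z - q) \<le> r / 2"
          using Pq by (auto simp: P_def dist_norm norm_minus_commute)
        finally show ?thesis
          using \<tau>(3) by (intro bexI[of _ "z + \<tau> *\<^sub>R (y q - q)"]) auto
      qed
      obtain w w' where w: "w \<in> U i" "dist w p \<le> K * r + r / 2" "w' \<in> U i" "dist w' q \<le> K * r + r / 2"
        using near[OF pq(1)] near[OF pq(2)] by blast
      have "dist w w' \<le> r"
        using diameter_bounded_bound[OF U(2) w(1,3)] U(3)[of i] by linarith
      moreover have "dist p q \<le> dist w p + dist w w' + dist w' q"
        using dist_triangle[of p q w] dist_triangle[of w q w'] by (simp add: dist_commute)
      \<comment> \<open>Both centres are within \<open>K * r + r / 2\<close> of \<open>U i\<close>,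
        whose diameter is at most \<open>r\<close>.\<close>
      ultimately have "dist p q \<le> 2 * (K * r) + 2 * r"
        using w by linarith
      also have "\<dots> \<le> (2 * K + 4) * r"
        using r by (simp add: algebra_simps)
      finally show ?thesis
        using Q(3) pq unfolding pairwise_def P_def by (meson not_less)
    qed
    \<comment> \<open>The only centre whose paths can meet \<open>U i\<close>; if there is none, the
      value is arbitrary and \<open>W i\<close> is a harmless extra set.\<close>
    define j where "j = (\<lambda>i. SOME q. \<exists>z. P q z i)"
    have j: "j i = q" if "P q z i" for q z i
      using that P_unique unfolding j_def by (intro some_equality) blast+
    have "\<exists>W. W \<in> sets borel \<and> {z \<in> cball (j i) (r / 2). \<exists>\<tau>. z + \<tau> *\<^sub>R (y (j i) - j i) \<in> U i} \<subseteq> W \<and>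
        emeasure lborel W \<le> ennreal C * hausdorff_gauge (real d - 1) (U i)" for i
      by (rule cylinder_cover[OF U(2)[of i] U(3)[of i] r, of "j i" "y (j i) - j i",
            folded d_def, folded C_def]) blast
    then have "\<forall>i. \<exists>W. W \<in> sets borel \<and> {z \<in> cball (j i) (r / 2). \<exists>\<tau>. z + \<tau> *\<^sub>R (y (j i) - j i) \<in> U i} \<subseteq> W \<and>
        emeasure lborel W \<le> ennreal C * hausdorff_gauge (real d - 1) (U i)" ..
    from choice[OF this] obtain W where W: "\<And>i. W i \<in> sets borel"
      "\<And>i. {z \<in> cball (j i) (r / 2). \<exists>\<tau>. z + \<tau> *\<^sub>R (y (j i) - j i) \<in> U i} \<subseteq> W i"
      "\<And>i. emeasure lborel (W i) \<le> ennreal C * hausdorff_gauge (real d - 1) (U i)"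
      by blast
    have sub: "(\<Union>q\<in>Q. cball q (r / 2)) \<subseteq> (\<Union>i. W i)"
    proof safe
      fix q z assume q: "q \<in> Q" and z: "z \<in> cball q (r / 2)"
      have zq: "dist z q \<le> r / 2"
        using z by (simp add: dist_commute)
      \<comment> \<open>The path starts within \<open>r / 2\<close> of \<open>E\<close> and ends
        within \<open>r / 2\<close> of \<open>y q\<close>, hence at distance at least
        \<open>3 * r / 2\<close> from \<open>E\<close>.\<close>
      have "infdist z E \<le> r"
        using infdist_le[of q E z] Q(2) q zq r by (auto intro: order_trans)
      moreover have "infdist (y q) E \<le> infdist (z + (y q - q)) E + dist (y q) (z + (y q - q))"
        by (rule infdist_triangle)
      then have "r \<le> infdist (z + (y q - q)) E"
        using y(2)[OF q] zq r by (simp add: dist_norm norm_minus_commute)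
      ultimately obtain \<tau> where \<tau>: "0 \<le> \<tau>" "\<tau> \<le> 1" "infdist (z + \<tau> *\<^sub>R (y q - q)) E = r"
        by (rule level_set_crossing)
      then obtain i where i: "z + \<tau> *\<^sub>R (y q - q) \<in> U i"
        using U(1) by blast
      then have "P q z i"
        using \<tau> q z by (auto simp: P_def)
      then have "j i = q"
        by (rule j)
      then have "z \<in> W i"
        using W(2)[of i] i z by blast
      then show "z \<in> (\<Union>i. W i)"
        by blast
    qed
    have "disjoint_family_on (\<lambda>q. cball q (r / 2)) Q"
      unfolding disjoint_family_on_def
    proof (intro ballI impI disjoint_cballI)
      fix p q assume "p \<in> Q" "q \<in> Q" "p \<noteq> q"
      then have "(2 * K + 4) * r < dist p q"
        using Q(3) by (auto simp: pairwise_def)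
      moreover have "1 * r \<le> (2 * K + 4) * r"
        using K r by (intro mult_right_mono) auto
      ultimately show "r / 2 + r / 2 < dist p q"
        by simp
    qed
    then have "(\<Sum>q\<in>Q. emeasure lborel (cball q (r / 2))) = emeasure lborel (\<Union>q\<in>Q. cball q (r / 2))"
      using Q(1) by (intro sum_emeasure) auto
    \<comment> \<open>\<open>X\<close> is chosen so that \<open>C * X\<close> is the total volume of
      the balls.\<close>
    moreover have "(\<Sum>q\<in>Q. emeasure lborel (cball q (r / 2))) = ennreal C * ennreal X"
    proof -
      have "(\<Sum>q\<in>Q. emeasure lborel (cball q (r / 2))) = ennreal (real (card Q) * (unit_ball_vol d * (r / 2) ^ d))"
        using r by (simp add: emeasure_cball d_def ennreal_mult ennreal_of_nat_eq_real_of_nat)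
      also have "real (card Q) * (unit_ball_vol d * (r / 2) ^ d) = C * X"
      proof -
        have "r powr (real d - 1) = r ^ (d - 1)"
          using r d powr_realpow[of r "d - 1"] by (simp add: of_nat_diff)
        moreover have "r ^ d = r * r ^ (d - 1)"
          using d power_Suc[of r "d - 1"] by simp
        moreover have "(4::real) ^ d = 2 ^ d * 2 ^ d"
          by (simp add: power_mult_distrib[symmetric])
        ultimately show ?thesis
          by (simp add: C_def X_def power_divide)
      qed
      finally show ?thesis
        using C ennreal_mult[of C X] by (simp add: X_def)
    qed
    moreover have "emeasure lborel (\<Union>q\<in>Q. cball q (r / 2)) \<le> emeasure lborel (\<Union>i. W i)"
      using sub W(1) by (intro emeasure_mono) auto
    moreover have "emeasure lborel (\<Union>i. W i) \<le> (\<Sum>i. emeasure lborel (W i))"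
      using W(1) by (intro emeasure_subadditive_countably) auto
    moreover have "(\<Sum>i. emeasure lborel (W i)) \<le> (\<Sum>i. ennreal C * hausdorff_gauge (real d - 1) (U i))"
      using W(3) by (intro suminf_le) auto
    ultimately have "ennreal C * ennreal X \<le> ennreal C * (\<Sum>i. hausdorff_gauge (real d - 1) (U i))"
      by simp
    then show ?thesis
      using C by (simp add: ennreal_mult_le_mult_iff)
  qed
  \<comment> \<open>The measure is a supremum over all scales, so a bound at the single scale
    \<open>r\<close> suffices.\<close>
  then have "ennreal X \<le> hausdorff_content (real d - 1) r ?S"
    unfolding hausdorff_content_def by (intro INF_greatest) auto
  also have "\<dots> \<le> hausdorff_measure (real d - 1) ?S"
    unfolding hausdorff_measure_def using r by (intro SUP_upper) auto
  finally show ?thesis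
    by (simp add: X_def)
qed

text \<open>Porosity: if all of \<open>cball x (K r)\<close> were within \<open>2 r\<close> of \<open>E\<close>, then covering it by balls of
  radius \<open>4 r\<close> centred at \<open>E\<close> would take about \<open>K\<^sup>d\<close> of them, while regularity allows only
  about \<open>K\<^sup>s\<close>.\<close>

lemma (in regular_measure) exists_hole:
  assumes "s < real DIM('a)"
  obtains K where "3 \<le> K"
    "\<And>x r. x \<in> E \<Longrightarrow> 0 < r \<Longrightarrow> (K + 3) * r < diameter E \<Longrightarrow> \<exists>y. norm (y - x) \<le> K * r \<and> 2 * r \<le> infdist y E"
proof -
  define d where "d = DIM('a)"
  have ds: "0 < real d - s"
    using assms by (simp add: d_def)
  define c where "c = A\<^sup>2 * 2 powr s * 4 ^ d"
  have c: "0 \<le> c"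
    by (simp add: c_def)
  \<comment> \<open>This makes \<open>K powr (d - s)\<close> exceed \<open>c\<close>, whereas the
    absence of a hole will force \<open>K ^ d \<le> c * K powr s\<close>.\<close>
  define K where "K = max 3 ((c + 1) powr (1 / (real d - s)))"
  have K: "3 \<le> K"
    by (simp add: K_def)
  have "((c + 1) powr (1 / (real d - s))) powr (real d - s) \<le> K powr (real d - s)"
    using ds by (intro powr_mono2) (auto simp: K_def)
  then have Kc: "c < K powr (real d - s)"
    using ds c by (simp add: powr_powr)
  have "\<exists>y. norm (y - x) \<le> K * r \<and> 2 * r \<le> infdist y E"
    if x: "x \<in> E" and r: "0 < r" "(K + 3) * r < diameter E" for x r
  proof (rule ccontr)
    assume "\<not> ?thesis"
    then have no: "\<not> (norm (y - x) \<le> K * r \<and> 2 * r \<le> infdist y E)" for y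
      by blast
    have no_hole: "infdist y E < 2 * r" if "y \<in> cball x (K * r)" for y
      using no[of y] that by (simp add: dist_norm norm_minus_commute[of x y] not_le)
    have "1 * r \<le> (K + 3) * r"
      using K r by (intro mult_right_mono) auto
    then have rd: "r < diameter E"
      using r by linarith
    \<comment> \<open>One maximal separated set serves twice: its balls of radius \<open>r\<close>
      are disjoint, which bounds its size by regularity, and its balls of radius
      \<open>4 * r\<close> cover \<open>cball x (K * r)\<close>. The margin \<open>2 * r\<close>
      captures the nearest points of that ball in \<open>E\<close>.\<close>
    have "compact (E \<inter> cball x ((K + 2) * r))"
      using compact_E by (intro compact_Int_closed) auto
    then obtain Q where Q: "finite Q" "Q \<subseteq> E \<inter> cball x ((K + 2) * r)"
      "pairwise (\<lambda>p q. 2 * r < dist p q) Q" "E \<inter> cball x ((K + 2) * r) \<subseteq> (\<Union>q\<in>Q. cball q (2 * r))"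
      using compact_maximal_separated[of "E \<inter> cball x ((K + 2) * r)" "2 * r"] r(1) by auto
    have "real (card Q) * r powr s \<le> A * measure M (cball x ((K + 3) * r) \<inter> E)"
    proof (rule card_separated_le[OF Q(1) _ Q(3) r(1) rd])
      show "Q \<subseteq> E"
        using Q(2) by blast
      fix q assume "q \<in> Q"
      then have "dist x q \<le> (K + 2) * r"
        using Q(2) by auto
      then have "cball q r \<subseteq> cball x ((K + 3) * r)"
        by (subst cball_subset_cball_iff) (simp add: dist_commute algebra_simps)
      then show "cball q r \<inter> E \<subseteq> cball x ((K + 3) * r) \<inter> E"
        by blast
    qed auto
    also have "\<dots> \<le> A * (A * ((K + 3) * r) powr s)"
      using regular[OF x _ r(2)] r K A_ge_1 by (intro mult_left_mono) auto
    \<comment> \<open>\<open>K \<ge> 3\<close> gives \<open>K + 3 \<le> 2 * K\<close>.\<close>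
    also have "\<dots> \<le> A * (A * ((2 * K) * r) powr s)"
      using K r A_ge_1 s_pos by (intro mult_left_mono powr_mono2 mult_right_mono) auto
    also have "\<dots> = (A\<^sup>2 * 2 powr s * K powr s) * r powr s"
      using K r by (simp add: powr_mult power2_eq_square)
    finally have N: "real (card Q) \<le> A\<^sup>2 * 2 powr s * K powr s"
      using r by simp
    have "cball x (K * r) \<subseteq> (\<Union>q\<in>Q. cball q (4 * r))"
    proof
      fix y assume y: "y \<in> cball x (K * r)"
      obtain e where e: "e \<in> E" "infdist y E = dist y e"
        using infdist_attains_inf[OF compact_imp_closed[OF compact_E], of y] x by blast
      have ye: "dist y e < 2 * r"
        using no_hole[OF y] e by simp
      have "dist x e \<le> K * r + 2 * r"
        using dist_triangle[of x e y] y ye by simp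
      then have "e \<in> E \<inter> cball x ((K + 2) * r)"
        using e by (simp add: algebra_simps)
      then obtain q where q: "q \<in> Q" "dist q e \<le> 2 * r"
        using Q(4) by auto
      have "dist q y \<le> 4 * r"
        using dist_triangle2[of q y e] q ye by simp
      then show "y \<in> (\<Union>q\<in>Q. cball q (4 * r))"
        using q(1) by auto
    qed
    then have "emeasure lborel (cball x (K * r)) \<le> emeasure lborel (\<Union>q\<in>Q. cball q (4 * r))"
      using Q(1) by (intro emeasure_mono) auto
    also have "\<dots> \<le> (\<Sum>q\<in>Q. emeasure lborel (cball q (4 * r)))"
      using Q(1) by (intro emeasure_subadditive_finite) auto
    also have "\<dots> = ennreal (real (card Q) * (unit_ball_vol d * (4 * r) ^ d))"
      using r by (simp add: emeasure_cball d_def ennreal_mult ennreal_of_nat_eq_real_of_nat)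
    finally have "unit_ball_vol d * (K * r) ^ d \<le> real (card Q) * (unit_ball_vol d * (4 * r) ^ d)"
      using r K by (simp add: emeasure_cball d_def ennreal_le_iff)
    then have "(unit_ball_vol d * r ^ d) * K ^ d \<le> (unit_ball_vol d * r ^ d) * (real (card Q) * 4 ^ d)"
      by (simp add: power_mult_distrib mult_ac)
    then have "K ^ d \<le> real (card Q) * 4 ^ d"
      by (rule mult_left_le_imp_le) (use r in simp)
    also have "\<dots> \<le> (A\<^sup>2 * 2 powr s * K powr s) * 4 ^ d"
      using N by (intro mult_right_mono) auto
    also have "\<dots> = c * K powr s"
      by (simp add: c_def)
    also have "\<dots> < K powr (real d - s) * K powr s"
      using Kc K by (intro mult_strict_right_mono) auto
    also have "\<dots> = K ^ d"
      using K by (simp add: powr_add[symmetric] powr_realpow)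
    finally show False
      by simp
  qed
  with K show ?thesis
    by (rule that)
qed

section \<open>Choice of constants and combination of the two bounds\<close>

theorem corollary5p9:
  fixes E :: "'a::euclidean_space set" and s :: real
  assumes "0 < s" and "s < real DIM('a)"
    and "compact E" and "regular_set s E"
    and "\<exists>x\<in>E. \<exists>y\<in>E. x \<noteq> y"
  shows "\<exists>C\<ge>1. \<exists>c>0. \<exists>r\<^sub>0>0. \<forall>r. 0 < r \<and> r < r\<^sub>0 \<longrightarrow>
    ennreal (c * r powr (real DIM('a) - 1 - s))
      \<le> hausdorff_measure (real DIM('a) - 1) {x. infdist x E = r} \<and>
    hausdorff_measure (real DIM('a) - 1) {x. infdist x E = r}
      \<le> ennreal (C * r powr (real DIM('a) - 1 - s))"
proof -
  obtain M A where "regular_measure M E s A"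
    using regular_set_imp_regular_measure[OF assms(3,4,1)] assms(5) by blast
  then interpret regular_measure M E s A .
  obtain K where K: "3 \<le> K"
    and hole: "\<And>x r. x \<in> E \<Longrightarrow> 0 < r \<Longrightarrow> (K + 3) * r < diameter E \<Longrightarrow>
      \<exists>y. norm (y - x) \<le> K * r \<and> 2 * r \<le> infdist y E"
    using exists_hole[OF assms(2)] by blast
  define d where "d = DIM('a)"
  define B where "B = 34 * real d ^ 2 * (15 * real d ^ 2) ^ (d - 1)"
  define C where "C = max 1 (B * (A * measure M E * 2 powr s))"
  \<comment> \<open>The separation demanded by \<open>hausdorff_measure_level_set_ge\<close>; as
    \<open>L \<ge> K + 3\<close>, the bound \<open>L * r < diameter E\<close> also allows the use of
    \<open>hole\<close>.\<close>
  define L where "L = 2 * K + 4"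
  define c where "c = measure M E / (A * L powr s) / (9 * 4 ^ d)"
  have L: "0 < L" "K + 3 \<le> L" "1 \<le> L"
    using K by (simp_all add: L_def)
  have c: "0 < c"
    using measure_pos A_ge_1 L by (simp add: c_def)
  have E: "closed E" "E \<noteq> {}" "E \<in> sets M"
    using assms(5) compact_imp_closed[OF compact_E] sets.top[of M] by (auto simp: space_M)
  let ?H = "\<lambda>r. hausdorff_measure (real d - 1) {x. infdist x E = r}"
  have main: "ennreal (c * r powr (real d - 1 - s)) \<le> ?H r \<and> ?H r \<le> ennreal (C * r powr (real d - 1 - s))"
    if r: "0 < r" "r < diameter E / L" for r
  proof
    have Lr: "L * r < diameter E"
      using r L by (simp add: field_simps)
    have "1 * r \<le> L * r" "(K + 3) * r \<le> L * r"
      using L r by (intro mult_right_mono; simp)+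
    then have rd: "r < diameter E" "(K + 3) * r < diameter E"
      using Lr by linarith+
    have split: "r powr (real d - 1) = r powr (real d - 1 - s) * r powr s"
      using r by (simp add: powr_add[symmetric])

    \<comment> \<open>The balls of radius \<open>r\<close> cover \<open>E\<close>, as the cell count
      needs, and those of radius \<open>r / 2\<close> are disjoint, which gives at most about
      \<open>r powr (- s)\<close> of them.\<close>
    obtain Q where Q: "finite Q" "Q \<subseteq> E" "pairwise (\<lambda>x y. r < dist x y) Q" "E \<subseteq> (\<Union>x\<in>Q. cball x r)"
      using compact_maximal_separated[OF compact_E r(1)] .
    have "real (card Q) * (r / 2) powr s \<le> A * measure M E"
      using Q(3) r rd E(3) by (intro card_separated_le[OF Q(1,2)]) auto
    then have N: "real (card Q) * r powr s \<le> A * measure M E * 2 powr s"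
      using r by (simp add: powr_divide field_simps)
    have "?H r \<le> ennreal (B * real (card Q) * r powr (real d - 1))"
      using hausdorff_measure_level_set_le[OF E(1,2) Q(1,4) r(1)] by (simp add: B_def d_def)
    also have "\<dots> \<le> ennreal (C * r powr (real d - 1 - s))"
    proof (rule ennreal_leI)
      have "B * real (card Q) * r powr (real d - 1) = B * (real (card Q) * r powr s) * r powr (real d - 1 - s)"
        by (simp add: split)
      also have "\<dots> \<le> B * (A * measure M E * 2 powr s) * r powr (real d - 1 - s)"
        using N by (intro mult_right_mono mult_left_mono) (auto simp: B_def)
      also have "\<dots> \<le> C * r powr (real d - 1 - s)"
        by (intro mult_right_mono) (auto simp: C_def)
      finally show "B * real (card Q) * r powr (real d - 1) \<le> C * r powr (real d - 1 - s)" .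
    qed
    finally show "?H r \<le> ennreal (C * r powr (real d - 1 - s))" .

    have Lr0: "0 < L * r"
      using L r by simp
    \<comment> \<open>At scale \<open>L * r\<close> the covering property bounds the number of
      centres from below, and the separation lets the volumes at different centres be added.\<close>
    obtain R where R: "finite R" "R \<subseteq> E" "pairwise (\<lambda>x y. L * r < dist x y) R" "E \<subseteq> (\<Union>x\<in>R. cball x (L * r))"
      using compact_maximal_separated[OF compact_E Lr0] .
    have "measure M E \<le> real (card R) * (A * (L * r) powr s)"
      using measure_le_card_cover[OF R(1,2,4) Lr0 Lr] .
    also have "\<dots> = (A * L powr s) * (real (card R) * r powr s)"
      using L r by (simp add: powr_mult)
    finally have "measure M E / (A * L powr s) \<le> real (card R) * r powr s"
      using A_ge_1 L by (simp add: pos_divide_le_eq mult_ac)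
    then have "measure M E / (A * L powr s) / (9 * 4 ^ d) \<le> real (card R) * r powr s / (9 * 4 ^ d)"
      by (rule divide_right_mono) simp
    then have "c * r powr (real d - 1 - s) \<le> real (card R) * r powr s / (9 * 4 ^ d) * r powr (real d - 1 - s)"
      unfolding c_def by (rule mult_right_mono) simp
    also have "\<dots> = real (card R) * r powr (real d - 1) / (9 * 4 ^ d)"
      by (simp add: split)
    finally have "ennreal (c * r powr (real d - 1 - s)) \<le> ennreal (real (card R) * r powr (real d - 1) / (9 * 4 ^ d))"
      by (rule ennreal_leI)
    also have "\<dots> \<le> ?H r"
    proof -
      have "\<forall>q\<in>R. \<exists>y. norm (y - q) \<le> K * r \<and> 2 * r \<le> infdist y E"
        using hole r rd R(2) by blast
      then obtain y where "\<forall>q\<in>R. norm (y q - q) \<le> K * r \<and> 2 * r \<le> infdist (y q) E"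
        by (auto simp only: bchoice_iff)
      then show ?thesis
        using hausdorff_measure_level_set_ge[OF R(1,2) R(3)[unfolded L_def] r(1), of y] K
        by (simp add: d_def)
    qed
    finally show "ennreal (c * r powr (real d - 1 - s)) \<le> ?H r" .
  qed
  moreover have "0 < diameter E / L"
    using diam_pos L by simp
  moreover have "1 \<le> C"
    by (simp add: C_def)
  ultimately show ?thesis
    using c unfolding d_def by blast
qed

end
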